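(* Let $X_1,X_2,Z$ be diffeological spaces and let $f:X_1\supset Y\to X_2$ be a smooth map. Then the map $$\mathcal{F}_Z:C^\infty(X_1,Z)\times_{comp}C^\infty(X_2,Z)\to C^\infty(X_1\cup_fX_2,Z),\qquad(\varphi_1,\varphi_2)\mapsto\varphi_1\cup_f\varphi_2,$$ is smooth.
   Context: A diffeological space is a set $X$ with a collection of maps (plots) $U\to X$, $U$ open in some $\mathbb{R}^n$, containing constant maps, closed under precomposition with usual smooth maps, and satisfying the sheaf condition. A map is smooth if it carries plots to plots. Subsets carry the subset diffeology (plots with image in the subset), products the product diffeology (componentwise plots), quotients the quotient diffeology (maps locally lifting to plots), disjoint unions the disjoint union diffeology (maps locally equal to plots of one component). $C^\infty(X,Z)$ is the set of smooth maps $X\to Z$ with the functional diffeology, the coarsest one making evaluation $C^\infty(X,Z)\times X\to Z$ smooth: $p:U\to C^\infty(X,Z)$ is a plot iff for every plot $q:U'\to X$ the map $(u,u')\mapsto p(u)(q(u'))$ is a plot of $Z$. $Y\subset X_1$ has the subset diffeology. $X_1\cup_fX_2=(X_1\sqcup X_2)/\sim$, with $\sim$ generated by $y\sim f(y)$ for $y\in Y$, carries the quotient diffeology of the disjoint union diffeology. Let $i_1:X_1\setminus Y\hookrightarrow X_1\cup_fX_2$ and $i_2:X_2\hookrightarrow X_1\cup_fX_2$ be the maps induced by the inclusions; they are injective with images disjointly covering $X_1\cup_fX_2$. Smooth maps $\varphi_1:X_1\to Z$, $\varphi_2:X_2\to Z$ are $f$-compatible if $\varphi_1(y)=\varphi_2(f(y))$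 for all $y\in Y$. For such maps, $\varphi_1\cup_f\varphi_2:X_1\cup_fX_2\to Z$ is the (smooth) map equal to $\varphi_1(i_1^{-1}(x))$ for $x\in i_1(X_1\setminus Y)$ and to $\varphi_2(i_2^{-1}(x))$ for $x\in i_2(X_2)$. $C^\infty(X_1,Z)\times_{comp}C^\infty(X_2,Z)$ is the set of all pairs of $f$-compatible maps, with the subset diffeology from the product of the functional diffeologies. *)

theory Defs
  imports "HOL-Analysis.Analysis"
begin

section \<open>Smooth maps between open subsets of Euclidean spaces\<close>

text \<open>
  The dimension of the domain of a plot varies inside the definition of a diffeology, so it cannot
  be a type. The space of dimension \<open>n\<close> is therefore \<^const>\<open>Euclidean_space\<close> \<open>n\<close>, whose points are
  the functions \<open>nat \<Rightarrow> real\<close> that vanish at all indices \<open>\<ge> n\<close>.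
\<close>

text \<open>
  \<open>C_k k n U g\<close>: the real function \<open>g\<close> on the open set \<open>U\<close> of the \<open>n\<close>-dimensional space has
  continuous partial derivatives of all orders up to \<open>k\<close>. The derivatives only involve values of
  \<open>g\<close> on \<open>U\<close>, because \<open>U\<close> is open.
\<close>

primrec C_k :: "nat \<Rightarrow> nat \<Rightarrow> (nat \<Rightarrow> real) set \<Rightarrow> ((nat \<Rightarrow> real) \<Rightarrow> real) \<Rightarrow> bool" where
  "C_k 0 n U g \<longleftrightarrow> continuous_on U g"
| "C_k (Suc k) n U g \<longleftrightarrow> continuous_on U g \<and>
     (\<forall>i<n. (\<forall>x\<in>U. (\<lambda>t. g (x(i := t))) differentiable (at (x i))) \<and>
            C_k k n U (\<lambda>x. deriv (\<lambda>t. g (x(i := t))) (x i)))"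

definition smooth_Euclidean ::
  "nat \<Rightarrow> (nat \<Rightarrow> real) set \<Rightarrow> nat \<Rightarrow> (nat \<Rightarrow> real) set \<Rightarrow> ((nat \<Rightarrow> real) \<Rightarrow> nat \<Rightarrow> real) \<Rightarrow> bool" where
  "smooth_Euclidean m V n U h \<longleftrightarrow>
     openin (Euclidean_space m) V \<and> openin (Euclidean_space n) U \<and> h \<in> V \<rightarrow> U \<and>
     (\<forall>i<n. \<forall>k. C_k k m V (\<lambda>x. h x i))"

text \<open>
  The product of a subset of the \<open>n\<close>-dimensional and a subset of the \<open>m\<close>-dimensional space lives in
  the space of dimension \<open>n + m\<close>: the first factor occupies the coordinates below \<open>n\<close>.
\<close>

definition fst_part :: "nat \<Rightarrow> (nat \<Rightarrow> real) \<Rightarrow> nat \<Rightarrow> real" where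
  "fst_part n w = (\<lambda>i. if i < n then w i else 0)"

definition snd_part :: "nat \<Rightarrow> (nat \<Rightarrow> real) \<Rightarrow> nat \<Rightarrow> real" where
  "snd_part n w = (\<lambda>i. w (n + i))"

definition Euclidean_prod ::
  "nat \<Rightarrow> (nat \<Rightarrow> real) set \<Rightarrow> nat \<Rightarrow> (nat \<Rightarrow> real) set \<Rightarrow> (nat \<Rightarrow> real) set" where
  "Euclidean_prod n U m U' =
     {w \<in> topspace (Euclidean_space (n + m)). fst_part n w \<in> U \<and> snd_part n w \<in> U'}"


section \<open>Diffeological spaces and smooth maps\<close>

text \<open>
  \<open>plot X n U p\<close> says that \<open>p\<close> restricted to the open subset \<open>U\<close> of the \<open>n\<close>-dimensional space is a
  plot of \<open>X\<close>. The values of \<open>p\<close> outside \<open>U\<close> are irrelevant, which is what \<open>plot_cong\<close> expresses.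
\<close>

record 'a diffsp =
  points :: "'a set"
  plot :: "nat \<Rightarrow> (nat \<Rightarrow> real) set \<Rightarrow> ((nat \<Rightarrow> real) \<Rightarrow> 'a) \<Rightarrow> bool"

locale diffeological_space =
  fixes X :: "'a diffsp"
  assumes plot_open: "plot X n U p \<Longrightarrow> openin (Euclidean_space n) U"
    and plot_into: "plot X n U p \<Longrightarrow> p \<in> U \<rightarrow> points X"
    and plot_cong: "plot X n U p \<Longrightarrow> (\<And>u. u \<in> U \<Longrightarrow> p u = q u) \<Longrightarrow> plot X n U q"
    and plot_const: "openin (Euclidean_space n) U \<Longrightarrow> x \<in> points X \<Longrightarrow> plot X n U (\<lambda>u. x)"
    and plot_comp: "plot X n U p \<Longrightarrow> smooth_Euclidean m V n U h \<Longrightarrow> plot X m V (p \<circ> h)"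
    and plot_sheaf: "openin (Euclidean_space n) U \<Longrightarrow>
      (\<And>u. u \<in> U \<Longrightarrow> \<exists>V. openin (Euclidean_space n) V \<and> u \<in> V \<and> V \<subseteq> U \<and> plot X n V p) \<Longrightarrow>
      plot X n U p"

definition smooth_map :: "'a diffsp \<Rightarrow> 'b diffsp \<Rightarrow> ('a \<Rightarrow> 'b) \<Rightarrow> bool" where
  "smooth_map X Z g \<longleftrightarrow> g \<in> points X \<rightarrow> points Z \<and> (\<forall>n U p. plot X n U p \<longrightarrow> plot Z n U (g \<circ> p))"


section \<open>Constructions\<close>

definition subset_space :: "'a diffsp \<Rightarrow> 'a set \<Rightarrow> 'a diffsp" where
  "subset_space X A =
     \<lparr>points = A, plot = (\<lambda>n U p. plot X n U p \<and> p \<in> U \<rightarrow> A)\<rparr>"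

definition prod_space :: "'a diffsp \<Rightarrow> 'b diffsp \<Rightarrow> ('a \<times> 'b) diffsp" where
  "prod_space X Z =
     \<lparr>points = points X \<times> points Z,
      plot = (\<lambda>n U p. plot X n U (fst \<circ> p) \<and> plot Z n U (snd \<circ> p))\<rparr>"

definition sum_space :: "'a diffsp \<Rightarrow> 'b diffsp \<Rightarrow> ('a + 'b) diffsp" where
  "sum_space X Z =
     \<lparr>points = points X <+> points Z,
      plot = (\<lambda>n U p. openin (Euclidean_space n) U \<and>
        (\<forall>u\<in>U. \<exists>V. openin (Euclidean_space n) V \<and> u \<in> V \<and> V \<subseteq> U \<and>
           ((\<exists>q. plot X n V q \<and> (\<forall>v\<in>V. p v = Inl (q v))) \<or>
            (\<exists>q. plot Z n V q \<and> (\<forall>v\<in>V. p v = Inr (q v))))))\<rparr>"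

definition quotient_space :: "'a diffsp \<Rightarrow> ('a \<times> 'a) set \<Rightarrow> 'a set diffsp" where
  "quotient_space X R =
     \<lparr>points = points X // R,
      plot = (\<lambda>n U p. openin (Euclidean_space n) U \<and>
        (\<forall>u\<in>U. \<exists>V q. openin (Euclidean_space n) V \<and> u \<in> V \<and> V \<subseteq> U \<and>
           plot X n V q \<and> (\<forall>v\<in>V. p v = R `` {q v})))\<rparr>"

text \<open>
  Elements of a space of smooth maps are extensional, i.e. \<^const>\<open>undefined\<close> off the domain, so that
  equality of elements is equality of maps on the domain.
\<close>

definition C_infinity :: "'a diffsp \<Rightarrow> 'b diffsp \<Rightarrow> ('a \<Rightarrow> 'b) set" where
  "C_infinity X Z = {g \<in> extensional (points X). smooth_map X Z g}"

definition functional_space :: "'a diffsp \<Rightarrow> 'b diffsp \<Rightarrow> ('a \<Rightarrow> 'b) diffsp" where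
  "functional_space X Z =
     \<lparr>points = C_infinity X Z,
      plot = (\<lambda>n U p. openin (Euclidean_space n) U \<and> p \<in> U \<rightarrow> C_infinity X Z \<and>
        (\<forall>m U' q. plot X m U' q \<longrightarrow>
           plot Z (n + m) (Euclidean_prod n U m U') (\<lambda>w. p (fst_part n w) (q (snd_part n w)))))\<rparr>"


section \<open>Gluing along a map\<close>

definition generated_equiv :: "'a set \<Rightarrow> ('a \<times> 'a) set \<Rightarrow> ('a \<times> 'a) set" where
  "generated_equiv S r = \<Inter>{R. equiv S R \<and> r \<subseteq> R}"

definition gluing_rel ::
  "'a diffsp \<Rightarrow> 'a set \<Rightarrow> ('a \<Rightarrow> 'b) \<Rightarrow> 'b diffsp \<Rightarrow> (('a + 'b) \<times> ('a + 'b)) set" where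
  "gluing_rel X1 Y f X2 =
     generated_equiv (points X1 <+> points X2) ((\<lambda>y. (Inl y, Inr (f y))) ` Y)"

definition gluing_space ::
  "'a diffsp \<Rightarrow> 'a set \<Rightarrow> ('a \<Rightarrow> 'b) \<Rightarrow> 'b diffsp \<Rightarrow> ('a + 'b) set diffsp" where
  "gluing_space X1 Y f X2 = quotient_space (sum_space X1 X2) (gluing_rel X1 Y f X2)"

definition incl1 ::
  "'a diffsp \<Rightarrow> 'a set \<Rightarrow> ('a \<Rightarrow> 'b) \<Rightarrow> 'b diffsp \<Rightarrow> 'a \<Rightarrow> ('a + 'b) set" where
  "incl1 X1 Y f X2 x = gluing_rel X1 Y f X2 `` {Inl x}"

definition incl2 ::
  "'a diffsp \<Rightarrow> 'a set \<Rightarrow> ('a \<Rightarrow> 'b) \<Rightarrow> 'b diffsp \<Rightarrow> 'b \<Rightarrow> ('a + 'b) set" where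
  "incl2 X1 Y f X2 x = gluing_rel X1 Y f X2 `` {Inr x}"

definition compatible :: "'a set \<Rightarrow> ('a \<Rightarrow> 'b) \<Rightarrow> ('a \<Rightarrow> 'c) \<Rightarrow> ('b \<Rightarrow> 'c) \<Rightarrow> bool" where
  "compatible Y f \<phi>1 \<phi>2 \<longleftrightarrow> (\<forall>y\<in>Y. \<phi>1 y = \<phi>2 (f y))"

definition glued_map ::
  "'a diffsp \<Rightarrow> 'a set \<Rightarrow> ('a \<Rightarrow> 'b) \<Rightarrow> 'b diffsp \<Rightarrow> ('a \<Rightarrow> 'c) \<Rightarrow> ('b \<Rightarrow> 'c) \<Rightarrow> ('a + 'b) set \<Rightarrow> 'c" where
  "glued_map X1 Y f X2 \<phi>1 \<phi>2 = restrict
     (\<lambda>x. if x \<in> incl1 X1 Y f X2 ` (points X1 - Y)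
          then \<phi>1 (inv_into (points X1 - Y) (incl1 X1 Y f X2) x)
          else \<phi>2 (inv_into (points X2) (incl2 X1 Y f X2) x))
     (points (gluing_space X1 Y f X2))"

definition compatible_space ::
  "'a diffsp \<Rightarrow> 'a set \<Rightarrow> ('a \<Rightarrow> 'b) \<Rightarrow> 'b diffsp \<Rightarrow> 'c diffsp \<Rightarrow> (('a \<Rightarrow> 'c) \<times> ('b \<Rightarrow> 'c)) diffsp" where
  "compatible_space X1 Y f X2 Z =
     subset_space (prod_space (functional_space X1 Z) (functional_space X2 Z))
       {(\<phi>1, \<phi>2). \<phi>1 \<in> C_infinity X1 Z \<and> \<phi>2 \<in> C_infinity X2 Z \<and> compatible Y f \<phi>1 \<phi>2}"

end

theory Submission
  imports Defs
begin

text \<open>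
  The equivalence relation that defines the gluing is the kernel of the map sending each \<open>y \<in> Y\<close>
  in the first summand to \<open>f y\<close> in the second one and fixing everything else
  (\<open>gluing_rel_eq_kernel\<close>). Hence the glued map of a compatible pair is \<open>\<phi>1\<close> on the class of a
  point of \<open>X1\<close>, including the points of \<open>Y\<close>, and \<open>\<phi>2\<close> on the class of a point of \<open>X2\<close>
  (\<open>glued_map_class_Inl\<close>, \<open>glued_map_class_Inr\<close>).

  A plot of the glued space lifts, near each parameter, to a plot of \<open>X1\<close> or of \<open>X2\<close>
  (\<open>gluing_plot_local_lift\<close>). Evaluating a family of glued maps along it is therefore locally the
  evaluation of the family of first components along a plot of \<open>X1\<close>, or of the family of second
  components along a plot of \<open>X2\<close>. Both are plots of \<open>Z\<close> by the definition of the functional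
  diffeology, and the sheaf condition of \<open>Z\<close> puts the local pieces together.
\<close>

section \<open>Gluing local plots\<close>

text \<open>
  The domain of a plot is open, so a set covered by domains of plots is open too. Applied to plots
  on products of domains, this yields the openness of the product along with the plot.
\<close>

lemma (in diffeological_space) plot_if_locally_plot:
  assumes "\<And>u. u \<in> U \<Longrightarrow> \<exists>V. u \<in> V \<and> V \<subseteq> U \<and> plot X n V p"
  shows "plot X n U p"
proof (rule plot_sheaf)
  show cover: "\<exists>V. openin (Euclidean_space n) V \<and> u \<in> V \<and> V \<subseteq> U \<and> plot X n V p" if "u \<in> U" for u
  proof -
    from assms[OF that] obtain V where V: "u \<in> V" "V \<subseteq> U" "plot X n V p" by blast
    then show ?thesis using plot_open[OF V(3)] by blast
  qed
  show "openin (Euclidean_space n) U"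
    unfolding openin_subopen[of _ U]
  proof
    fix u assume "u \<in> U"
    from cover[OF this] show "\<exists>T. openin (Euclidean_space n) T \<and> u \<in> T \<and> T \<subseteq> U" by blast
  qed
qed

section \<open>The gluing relation\<close>

definition glue_rep :: "'a set \<Rightarrow> ('a \<Rightarrow> 'b) \<Rightarrow> 'a + 'b \<Rightarrow> 'a + 'b" where
  "glue_rep Y f s = (case s of Inl x \<Rightarrow> if x \<in> Y then Inr (f x) else Inl x | Inr z \<Rightarrow> Inr z)"

lemma glue_rep_simps [simp]:
  "glue_rep Y f (Inl x) = (if x \<in> Y then Inr (f x) else Inl x)"
  "glue_rep Y f (Inr z) = Inr z"
  by (simp_all add: glue_rep_def)

text \<open>
  The kernel is an equivalence relation containing the generating pairs. Conversely, these pairs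
  relate each point to its representative, so any equivalence relation containing them relates two
  points with equal representatives.
\<close>

lemma gluing_rel_eq_kernel:
  assumes "Y \<subseteq> points X1" and "f \<in> Y \<rightarrow> points X2"
  shows "gluing_rel X1 Y f X2 =
    {(s, t). s \<in> points X1 <+> points X2 \<and> t \<in> points X1 <+> points X2 \<and>
             glue_rep Y f s = glue_rep Y f t}" (is "_ = ?K")
proof
  let ?S = "points X1 <+> points X2" and ?r = "(\<lambda>y. (Inl y, Inr (f y))) ` Y"
  have "equiv ?S ?K"
    unfolding equiv_def refl_on_def sym_def trans_def by auto
  moreover have "?r \<subseteq> ?K"
    using assms by auto
  ultimately show "gluing_rel X1 Y f X2 \<subseteq> ?K"
    unfolding gluing_rel_def generated_equiv_def by blast
  have "?K \<subseteq> R" if R: "equiv ?S R" "?r \<subseteq> R" for R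
  proof clarify
    fix s t
    assume s: "s \<in> ?S" and t: "t \<in> ?S" and eq: "glue_rep Y f s = glue_rep Y f t"
    have rep: "(s, glue_rep Y f s) \<in> R" if "s \<in> ?S" for s
    proof (cases "s \<in> Inl ` Y")
      case True
      then show ?thesis using R(2) by auto
    next
      case False
      then have "glue_rep Y f s = s" by (cases s) auto
      then show ?thesis using R(1) that by (simp add: equiv_def refl_on_def)
    qed
    have "(glue_rep Y f t, t) \<in> R"
      using rep[OF t] R(1) by (auto simp: equiv_def dest: symD)
    then show "(s, t) \<in> R"
      using rep[OF s] R(1) eq by (auto simp: equiv_def dest: transD)
  qed
  then show "?K \<subseteq> gluing_rel X1 Y f X2"
    unfolding gluing_rel_def generated_equiv_def by blast
qed

lemma gluing_class_eq_iff:
  assumes "Y \<subseteq> points X1" and "f \<in> Y \<rightarrow> points X2"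
    and "s \<in> points X1 <+> points X2" and "t \<in> points X1 <+> points X2"
  shows "gluing_rel X1 Y f X2 `` {s} = gluing_rel X1 Y f X2 `` {t} \<longleftrightarrow>
    glue_rep Y f s = glue_rep Y f t"
  using assms(3,4)
  unfolding gluing_rel_eq_kernel[OF assms(1,2)] set_eq_iff Image_singleton_iff mem_Collect_eq
    case_prod_conv
  by metis

lemma points_gluing_space:
  "points (gluing_space X1 Y f X2) = incl1 X1 Y f X2 ` points X1 \<union> incl2 X1 Y f X2 ` points X2"
  unfolding gluing_space_def quotient_space_def sum_space_def quotient_def incl1_def incl2_def
  by (auto simp: Plus_def)

section \<open>Values of the glued map\<close>

lemma glued_map_class_Inr:
  assumes "Y \<subseteq> points X1" and "f \<in> Y \<rightarrow> points X2" and "z \<in> points X2"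
  shows "glued_map X1 Y f X2 \<phi>1 \<phi>2 (incl2 X1 Y f X2 z) = \<phi>2 z"
proof -
  note class_eq = gluing_class_eq_iff[OF assms(1,2)]
  have "inj_on (incl2 X1 Y f X2) (points X2)"
    by (rule inj_onI) (simp add: incl2_def class_eq InrI)
  moreover have "incl2 X1 Y f X2 z \<notin> incl1 X1 Y f X2 ` (points X1 - Y)"
  proof
    assume "incl2 X1 Y f X2 z \<in> incl1 X1 Y f X2 ` (points X1 - Y)"
    then obtain x where x: "x \<in> points X1" "x \<notin> Y"
      and eq: "incl2 X1 Y f X2 z = incl1 X1 Y f X2 x" by blast
    have "glue_rep Y f (Inr z) = glue_rep Y f (Inl x)"
      using eq class_eq[OF InrI[OF assms(3)] InlI[OF x(1)]] by (simp add: incl1_def incl2_def)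
    then show False using x(2) by simp
  qed
  ultimately show ?thesis
    using assms(3) by (simp add: glued_map_def points_gluing_space inv_into_f_f)
qed

text \<open>The class of a point \<open>y \<in> Y\<close> is that of \<open>f y\<close>; this is the case that needs compatibility.\<close>

lemma glued_map_class_Inl:
  assumes "Y \<subseteq> points X1" and "f \<in> Y \<rightarrow> points X2" and "x \<in> points X1"
    and "compatible Y f \<phi>1 \<phi>2"
  shows "glued_map X1 Y f X2 \<phi>1 \<phi>2 (incl1 X1 Y f X2 x) = \<phi>1 x"
proof (cases "x \<in> Y")
  case True
  then have fx: "f x \<in> points X2" using assms(2) by blast
  have "incl1 X1 Y f X2 x = incl2 X1 Y f X2 (f x)"
    using gluing_class_eq_iff[OF assms(1,2) InlI[OF assms(3)] InrI[OF fx]] True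
    by (simp add: incl1_def incl2_def)
  with fx show ?thesis
    using assms(4) True by (simp add: glued_map_class_Inr[OF assms(1,2)] compatible_def)
next
  case False
  have "inj_on (incl1 X1 Y f X2) (points X1 - Y)"
    by (rule inj_onI) (simp add: incl1_def gluing_class_eq_iff[OF assms(1,2)] InlI)
  then show ?thesis
    using assms(3) False by (simp add: glued_map_def points_gluing_space inv_into_f_f)
qed

section \<open>Plots of the glued space and of families of glued maps\<close>

lemma gluing_plot_local_lift:
  assumes "plot (gluing_space X1 Y f X2) n U q" and "u \<in> U"
  obtains V r where "u \<in> V" "V \<subseteq> U" "plot X1 n V r" "\<And>v. v \<in> V \<Longrightarrow> q v = incl1 X1 Y f X2 (r v)"
  | V r where "u \<in> V" "V \<subseteq> U" "plot X2 n V r" "\<And>v. v \<in> V \<Longrightarrow> q v = incl2 X1 Y f X2 (r v)"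
proof -
  from assms obtain W s where W: "u \<in> W" "W \<subseteq> U" "plot (sum_space X1 X2) n W s"
      "\<forall>v\<in>W. q v = gluing_rel X1 Y f X2 `` {s v}"
    unfolding gluing_space_def quotient_space_def by auto
  from W(1,3) obtain V where V: "u \<in> V" "V \<subseteq> W"
      "(\<exists>r. plot X1 n V r \<and> (\<forall>v\<in>V. s v = Inl (r v))) \<or>
       (\<exists>r. plot X2 n V r \<and> (\<forall>v\<in>V. s v = Inr (r v)))"
    unfolding sum_space_def by simp blast
  have "V \<subseteq> U" using V(2) W(2) by blast
  from V(3) show thesis
  proof (elim disjE exE conjE)
    fix r assume r: "plot X1 n V r" and s: "\<forall>v\<in>V. s v = Inl (r v)"
    have "q v = incl1 X1 Y f X2 (r v)" if "v \<in> V" for v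
      using W(4) V(2) s that by (auto simp: incl1_def)
    then show thesis
      using that(1) V(1) \<open>V \<subseteq> U\<close> r by blast
  next
    fix r assume r: "plot X2 n V r" and s: "\<forall>v\<in>V. s v = Inr (r v)"
    have "q v = incl2 X1 Y f X2 (r v)" if "v \<in> V" for v
      using W(4) V(2) s that by (auto simp: incl2_def)
    then show thesis
      using that(2) V(1) \<open>V \<subseteq> U\<close> r by blast
  qed
qed

lemma glued_map_in_C_infinity:
  assumes X1: "diffeological_space X1" and X2: "diffeological_space X2"
    and Z: "diffeological_space Z"
    and Y: "Y \<subseteq> points X1" and f: "f \<in> Y \<rightarrow> points X2"
    and \<phi>1: "smooth_map X1 Z \<phi>1" and \<phi>2: "smooth_map X2 Z \<phi>2" and comp: "compatible Y f \<phi>1 \<phi>2"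
  shows "glued_map X1 Y f X2 \<phi>1 \<phi>2 \<in> C_infinity (gluing_space X1 Y f X2) Z"
proof -
  interpret X1: diffeological_space X1 by fact
  interpret X2: diffeological_space X2 by fact
  interpret Z: diffeological_space Z by fact
  let ?g = "glued_map X1 Y f X2 \<phi>1 \<phi>2"
  note value1 = glued_map_class_Inl[OF Y f _ comp]
  note value2 = glued_map_class_Inr[OF Y f]
  have "plot Z n U (?g \<circ> q)" if q: "plot (gluing_space X1 Y f X2) n U q" for n U q
  proof (rule Z.plot_if_locally_plot)
    fix u assume "u \<in> U"
    from q this show "\<exists>V. u \<in> V \<and> V \<subseteq> U \<and> plot Z n V (?g \<circ> q)"
    proof (cases rule: gluing_plot_local_lift)
      case (1 V r)
      have "plot Z n V (\<phi>1 \<circ> r)" using \<phi>1 1(3) by (simp add: smooth_map_def)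
      then have "plot Z n V (?g \<circ> q)"
        by (rule Z.plot_cong) (simp add: 1(4) value1 funcset_mem[OF X1.plot_into[OF 1(3)]])
      then show ?thesis using 1 by blast
    next
      case (2 V r)
      have "plot Z n V (\<phi>2 \<circ> r)" using \<phi>2 2(3) by (simp add: smooth_map_def)
      then have "plot Z n V (?g \<circ> q)"
        by (rule Z.plot_cong) (simp add: 2(4) value2 funcset_mem[OF X2.plot_into[OF 2(3)]])
      then show ?thesis using 2 by blast
    qed
  qed
  moreover have "?g \<in> points (gluing_space X1 Y f X2) \<rightarrow> points Z"
    using \<phi>1 \<phi>2 by (auto simp: value1 value2 points_gluing_space smooth_map_def)
  moreover have "?g \<in> extensional (points (gluing_space X1 Y f X2))"
    by (simp add: glued_map_def)
  ultimately show ?thesis by (simp add: C_infinity_def smooth_map_def)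
qed

text \<open>
  Only the parameter of the plot \<open>q\<close> of the glued space has to be localised: over a domain \<open>V\<close> where
  \<open>q\<close> lifts to a plot of \<open>X1\<close> or \<open>X2\<close>, the evaluation is a plot of \<open>Z\<close> on the whole product
  of \<open>U\<close> and \<open>V\<close>.
\<close>

lemma eval_glued_family_plot:
  assumes X1: "diffeological_space X1" and X2: "diffeological_space X2"
    and Z: "diffeological_space Z"
    and Y: "Y \<subseteq> points X1" and f: "f \<in> Y \<rightarrow> points X2"
    and p1: "plot (functional_space X1 Z) n U p1" and p2: "plot (functional_space X2 Z) n U p2"
    and comp: "\<And>u. u \<in> U \<Longrightarrow> compatible Y f (p1 u) (p2 u)"
    and q: "plot (gluing_space X1 Y f X2) m U' q"
  shows "plot Z (n + m) (Euclidean_prod n U m U')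
    (\<lambda>w. glued_map X1 Y f X2 (p1 (fst_part n w)) (p2 (fst_part n w)) (q (snd_part n w)))"
    (is "plot Z _ _ ?g")
proof -
  interpret X1: diffeological_space X1 by fact
  interpret X2: diffeological_space X2 by fact
  interpret Z: diffeological_space Z by fact
  show ?thesis
  proof (rule Z.plot_if_locally_plot)
    fix w assume w: "w \<in> Euclidean_prod n U m U'"
    then have "snd_part n w \<in> U'" by (simp add: Euclidean_prod_def)
    from q this show "\<exists>W. w \<in> W \<and> W \<subseteq> Euclidean_prod n U m U' \<and> plot Z (n + m) W ?g"
    proof (cases rule: gluing_plot_local_lift)
      case (1 V r)
      have "plot Z (n + m) (Euclidean_prod n U m V) (\<lambda>w. p1 (fst_part n w) (r (snd_part n w)))"
        using p1 1(3) by (simp add: functional_space_def)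
      then have "plot Z (n + m) (Euclidean_prod n U m V) ?g"
      proof (rule Z.plot_cong)
        fix v assume "v \<in> Euclidean_prod n U m V"
        then have "fst_part n v \<in> U" "snd_part n v \<in> V" by (simp_all add: Euclidean_prod_def)
        then show "p1 (fst_part n v) (r (snd_part n v)) = ?g v"
          by (simp add: 1(4) glued_map_class_Inl[OF Y f _ comp] funcset_mem[OF X1.plot_into[OF 1(3)]])
      qed
      moreover have "w \<in> Euclidean_prod n U m V" "Euclidean_prod n U m V \<subseteq> Euclidean_prod n U m U'"
        using w 1(1,2) by (auto simp: Euclidean_prod_def)
      ultimately show ?thesis by blast
    next
      case (2 V r)
      have "plot Z (n + m) (Euclidean_prod n U m V) (\<lambda>w. p2 (fst_part n w) (r (snd_part n w)))"
        using p2 2(3) by (simp add: functional_space_def)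
      then have "plot Z (n + m) (Euclidean_prod n U m V) ?g"
      proof (rule Z.plot_cong)
        fix v assume "v \<in> Euclidean_prod n U m V"
        then have "snd_part n v \<in> V" by (simp add: Euclidean_prod_def)
        then show "p2 (fst_part n v) (r (snd_part n v)) = ?g v"
          by (simp add: 2(4) glued_map_class_Inr[OF Y f] funcset_mem[OF X2.plot_into[OF 2(3)]])
      qed
      moreover have "w \<in> Euclidean_prod n U m V" "Euclidean_prod n U m V \<subseteq> Euclidean_prod n U m U'"
        using w 2(1,2) by (auto simp: Euclidean_prod_def)
      ultimately show ?thesis by blast
    qed
  qed
qed

theorem theorem4p3:
  fixes X1 :: "'a diffsp" and X2 :: "'b diffsp" and Z :: "'c diffsp"
    and Y :: "'a set" and f :: "'a \<Rightarrow> 'b"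
  assumes "diffeological_space X1" and "diffeological_space X2" and "diffeological_space Z"
    and "Y \<subseteq> points X1"
    and "smooth_map (subset_space X1 Y) X2 f"
  shows "smooth_map (compatible_space X1 Y f X2 Z)
           (functional_space (gluing_space X1 Y f X2) Z)
           (\<lambda>(\<phi>1, \<phi>2). glued_map X1 Y f X2 \<phi>1 \<phi>2)"
proof -
  let ?C = "compatible_space X1 Y f X2 Z" and ?F = "functional_space (gluing_space X1 Y f X2) Z"
  let ?G = "\<lambda>(\<phi>1, \<phi>2). glued_map X1 Y f X2 \<phi>1 \<phi>2"
  have f: "f \<in> Y \<rightarrow> points X2"
    using assms(5) by (simp add: smooth_map_def subset_space_def)
  have into: "?G \<in> points ?C \<rightarrow> C_infinity (gluing_space X1 Y f X2) Z"
    using glued_map_in_C_infinity[OF assms(1-4) f]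
    by (auto simp: compatible_space_def subset_space_def C_infinity_def)
  have "plot ?F n U (?G \<circ> p)" if p: "plot ?C n U p" for n U p
  proof -
    have p12: "plot (functional_space X1 Z) n U (fst \<circ> p)"
        "plot (functional_space X2 Z) n U (snd \<circ> p)"
      and p_into: "p \<in> U \<rightarrow> points ?C"
      using p by (simp_all add: compatible_space_def subset_space_def prod_space_def)
    have comp: "compatible Y f ((fst \<circ> p) u) ((snd \<circ> p) u)" if "u \<in> U" for u
      using funcset_mem[OF p_into that]
      by (auto simp: compatible_space_def subset_space_def)
    have "openin (Euclidean_space n) U"
      using p12(1) by (simp add: functional_space_def)
    moreover have "?G \<circ> p \<in> U \<rightarrow> C_infinity (gluing_space X1 Y f X2) Z"
      using into p_into by (fastforce simp: Pi_iff)
    moreover have "plot Z (n + m) (Euclidean_prod n U m U')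
        (\<lambda>w. (?G \<circ> p) (fst_part n w) (q (snd_part n w)))"
      if "plot (gluing_space X1 Y f X2) m U' q" for m U' q
      using eval_glued_family_plot[OF assms(1-4) f p12 comp that]
      by (simp add: case_prod_beta)
    ultimately show ?thesis by (simp add: functional_space_def)
  qed
  then show ?thesis
    using into by (simp add: smooth_map_def functional_space_def)
qed

end
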